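(* $\mathbf{mCi}$ is not axiomatizable by a finite Set-Set H-system: there is no Set-Set H-system $\mathcal{H}$ with finitely many rule schemas such that, for all $\Gamma\cup\{\varphi\}\subseteq L$, $\Gamma\rhd_{\mathcal{H}}\{\varphi\}$ holds if and only if $\Gamma\vdash_{\mathbf{mCi}}\varphi$.
   Context: Let $\Sigma$ be the propositional signature with unary connectives $\neg,\circ$ and binary connectives $\land,\lor,\to$, and let $L$ be the set of $\Sigma$-formulas over a denumerable set $P$ of propositional variables. The logic $\mathbf{mCi}$ is the Tarskian consequence relation $\vdash_{\mathbf{mCi}}$ induced by the conventional (Set-Fmla) Hilbert system consisting of any Hilbert system for positive classical logic (the $\{\land,\lor,\to\}$-fragment of classical logic) extended with the axiom schemas $p\lor\neg p$; $\circ p\to(p\to(\neg p\to q))$; $\neg\circ p\to(p\land\neg p)$; and $\circ\neg^j\circ p$ for every $j\in\omega$ ($\neg^j$ being $j$-fold application of $\neg$). A Set-Set rule schema is a pair $(\Phi,\Psi)$ of finite sets of formulas, written $\Phi/\Psi$; its rule instances are all $(\sigma[\Phi],\sigma[\Psi])$ for substitutions $\sigma$. A Set-Set H-system $\mathcal{H}$ is a set of such rule schemas. An $\mathcal{H}$-derivation is a finite rooted tree whose nodes are labelled by sets of formulas or by a discontinuation symbol $*$, in which each non-leaf node with label $\Delta$ is expanded by some rule instance $\Phi/\Psi$ with $\Phi\subseteq\Delta$: if $\Psi\ne\varnothing$ the node has exactly one child for each $\psi\in\Psi$, labelled $\Delta\cup\{\psi\}$; if $\Psi=\varnothing$ it has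 a single child labelled $*$. An $\mathcal{H}$-proof of $(\Gamma,\Delta)$ is a derivation whose root label is contained in $\Gamma$ and each of whose leaves is labelled $*$ or by a set meeting $\Delta$. We write $\Gamma\rhd_{\mathcal{H}}\Delta$ iff there is an $\mathcal{H}$-proof of $(\Gamma,\Delta)$. *)

theory Defs
  imports Main "HOL-Library.Countable" "HOL-Library.Infinite_Typeclass"
begin

datatype 'v form =
    Var 'v
  | Neg "'v form"
  | Circ "'v form"
  | And "'v form" "'v form"
  | Or "'v form" "'v form"
  | Imp "'v form" "'v form"

primrec subst :: "('v \<Rightarrow> 'v form) \<Rightarrow> 'v form \<Rightarrow> 'v form" where
  "subst \<sigma> (Var x) = \<sigma> x"
| "subst \<sigma> (Neg A) = Neg (subst \<sigma> A)"
| "subst \<sigma> (Circ A) = Circ (subst \<sigma> A)"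
| "subst \<sigma> (And A B) = And (subst \<sigma> A) (subst \<sigma> B)"
| "subst \<sigma> (Or A B) = Or (subst \<sigma> A) (subst \<sigma> B)"
| "subst \<sigma> (Imp A B) = Imp (subst \<sigma> A) (subst \<sigma> B)"

text \<open>
  A standard axiomatization of positive classical logic with modus ponens as its only rule; the
  last schema separates it from positive intuitionistic logic. Axiom schemas are closed under
  substitution by ranging over arbitrary formulas.
\<close>

inductive positive_classical_axiom :: "'v form \<Rightarrow> bool" where
  "positive_classical_axiom (Imp A (Imp B A))"
| "positive_classical_axiom (Imp (Imp A (Imp B C)) (Imp (Imp A B) (Imp A C)))"
| "positive_classical_axiom (Imp A (Imp B (And A B)))"
| "positive_classical_axiom (Imp (And A B) A)"
| "positive_classical_axiom (Imp (And A B) B)"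
| "positive_classical_axiom (Imp A (Or A B))"
| "positive_classical_axiom (Imp B (Or A B))"
| "positive_classical_axiom (Imp (Imp A C) (Imp (Imp B C) (Imp (Or A B) C)))"
| "positive_classical_axiom (Or A (Imp A B))"

inductive mCi_axiom :: "'v form \<Rightarrow> bool" where
  positive: "positive_classical_axiom A \<Longrightarrow> mCi_axiom A"
| excluded_middle: "mCi_axiom (Or A (Neg A))"
| gentle_explosion: "mCi_axiom (Imp (Circ A) (Imp A (Imp (Neg A) B)))"
| inconsistency: "mCi_axiom (Imp (Neg (Circ A)) (And A (Neg A)))"
| consistency: "mCi_axiom (Circ ((Neg ^^ j) (Circ A)))"

inductive mCi :: "'v form set \<Rightarrow> 'v form \<Rightarrow> bool" (infix \<open>\<turnstile>\<^sub>m\<^sub>C\<^sub>i\<close> 50)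
  for \<Gamma> :: "'v form set" where
  premise: "A \<in> \<Gamma> \<Longrightarrow> \<Gamma> \<turnstile>\<^sub>m\<^sub>C\<^sub>i A"
| "axiom": "mCi_axiom A \<Longrightarrow> \<Gamma> \<turnstile>\<^sub>m\<^sub>C\<^sub>i A"
| modus_ponens: "\<Gamma> \<turnstile>\<^sub>m\<^sub>C\<^sub>i A \<Longrightarrow> \<Gamma> \<turnstile>\<^sub>m\<^sub>C\<^sub>i Imp A B \<Longrightarrow> \<Gamma> \<turnstile>\<^sub>m\<^sub>C\<^sub>i B"

type_synonym 'v rule_schema = "'v form set \<times> 'v form set"

definition set_set_system :: "'v rule_schema set \<Rightarrow> bool" where
  "set_set_system H \<longleftrightarrow> (\<forall>(\<Phi>, \<Psi>) \<in> H. finite \<Phi> \<and> finite \<Psi>)"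

definition rule_instances :: "'v rule_schema set \<Rightarrow> 'v rule_schema set" where
  "rule_instances H = {(subst \<sigma> ` \<Phi>, subst \<sigma> ` \<Psi>) | \<sigma> \<Phi> \<Psi>. (\<Phi>, \<Psi>) \<in> H}"

text \<open>\<open>Discontinued\<close> is the label written as a star.\<close>

datatype 'v label = Formulas "'v form set" | Discontinued

datatype 'v tree = Node (root_label: "'v label") (children: "'v tree list")

fun leaf_labels :: "'v tree \<Rightarrow> 'v label set" where
  "leaf_labels (Node l ts) = (if ts = [] then {l} else (\<Union>t \<in> set ts. leaf_labels t))"

text \<open>
  In \<open>branch\<close>, the distinct list \<open>\<psi>s\<close> enumerates the succedent, giving exactly one child per
  formula even when two children carry the same label. Nodes labelled \<open>Discontinued\<close> can only
  be leaves.
\<close>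

inductive derivation :: "'v rule_schema set \<Rightarrow> 'v tree \<Rightarrow> bool"
  for H :: "'v rule_schema set" where
  leaf: "derivation H (Node l [])"
| branch: "derivation H (Node (Formulas \<Delta>) ts)"
  if "(\<Phi>, \<Psi>) \<in> rule_instances H" "\<Phi> \<subseteq> \<Delta>" "\<Psi> \<noteq> {}"
    "distinct \<psi>s" "set \<psi>s = \<Psi>"
    "map root_label ts = map (\<lambda>\<psi>. Formulas (\<Delta> \<union> {\<psi>})) \<psi>s"
    "\<And>t. t \<in> set ts \<Longrightarrow> derivation H t"
| discontinue: "derivation H (Node (Formulas \<Delta>) [Node Discontinued []])"
  if "(\<Phi>, {}) \<in> rule_instances H" "\<Phi> \<subseteq> \<Delta>"

definition set_set_proof ::
  "'v rule_schema set \<Rightarrow> 'v form set \<Rightarrow> 'v form set \<Rightarrow> 'v tree \<Rightarrow> bool" where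
  "set_set_proof H \<Gamma> \<Delta> t \<longleftrightarrow>
     derivation H t \<and>
     (\<exists>\<Lambda>. root_label t = Formulas \<Lambda> \<and> \<Lambda> \<subseteq> \<Gamma>) \<and>
     (\<forall>l \<in> leaf_labels t. l = Discontinued \<or> (\<exists>\<Lambda>. l = Formulas \<Lambda> \<and> \<Lambda> \<inter> \<Delta> \<noteq> {}))"

definition set_set_conseq :: "'v rule_schema set \<Rightarrow> 'v form set \<Rightarrow> 'v form set \<Rightarrow> bool" where
  "set_set_conseq H \<Gamma> \<Delta> \<longleftrightarrow> (\<exists>t. set_set_proof H \<Gamma> \<Delta> t)"

end

theory Submission imports Defs
begin

text \<open>
  For each \<open>n > 0\<close> we build a bivaluation that behaves classically except that the negation of
  \<open>\<not>\<^sup>n\<circ>A\<close> is always true. It satisfies every axiom of mCi other than the instances of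
  \<open>\<circ>\<not>\<^sup>j\<circ>A\<close> with \<open>j \<ge> n\<close>, so each single mCi-derivation is sound for all large \<open>n\<close>; but for even
  \<open>n\<close> it falsifies \<open>\<circ>\<not>\<^sup>n\<circ>p\<close>. A Set-Set rule \<open>\<Phi>/\<Psi>\<close> that is sound for mCi yields \<open>\<Phi> \<turnstile> \<Or>\<Psi>\<close>, hence is
  valid, together with all its instances, in the bivaluations with large \<open>n\<close>. Finitely many
  rules share one such \<open>n\<close>, and then cannot prove the theorem \<open>\<circ>\<not>\<^sup>n\<circ>p\<close>.
\<close>

section \<open>Bivaluations with one nonclassical negation\<close>

definition neg_circ :: "nat \<Rightarrow> 'v form \<Rightarrow> bool" where
  "neg_circ n A \<longleftrightarrow> (\<exists>B. A = (Neg ^^ n) (Circ B))"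

text \<open>
  The clause for \<open>Circ A\<close> amounts to \<open>\<not> (val n A \<and> val n (Neg A))\<close>, in a structurally recursive form.
\<close>

primrec val :: "nat \<Rightarrow> 'v form \<Rightarrow> bool" where
  "val n (Var x) \<longleftrightarrow> True"
| "val n (Neg A) \<longleftrightarrow> neg_circ n A \<or> \<not> val n A"
| "val n (Circ A) \<longleftrightarrow> \<not> (neg_circ n A \<and> val n A)"
| "val n (And A B) \<longleftrightarrow> val n A \<and> val n B"
| "val n (Or A B) \<longleftrightarrow> val n A \<or> val n B"
| "val n (Imp A B) \<longleftrightarrow> (val n A \<longrightarrow> val n B)"

lemma Neg_funpow_Circ_inject:
  "(Neg ^^ m) (Circ A) = (Neg ^^ n) (Circ B) \<longleftrightarrow> m = n \<and> A = B"
proof (induction m arbitrary: n)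
  case 0
  then show ?case by (cases n) auto
next
  case (Suc m)
  then show ?case by (cases n) auto
qed

lemma neg_circ_Neg_funpow_Circ: "neg_circ n ((Neg ^^ m) (Circ A)) \<longleftrightarrow> m = n"
  by (auto simp: neg_circ_def Neg_funpow_Circ_inject)

lemma neg_circ_Circ: "neg_circ n (Circ A) \<longleftrightarrow> n = 0"
  using neg_circ_Neg_funpow_Circ[of n 0] by auto

lemma neg_circ_Var: "\<not> neg_circ n (Var x)"
  by (cases n) (auto simp: neg_circ_def)

text \<open>Below height \<open>n\<close> negation acts classically, and \<open>Circ (Var x)\<close>
  is true because no variable satisfies \<open>neg_circ n\<close>, so truth values alternate.
  Passing from \<open>m\<close> to \<open>Suc m\<close> only needs \<open>m < n\<close>, hence
  \<open>m = n\<close> is still covered.\<close>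

lemma val_Neg_funpow_Circ_Var:
  "m \<le> n \<Longrightarrow> val n ((Neg ^^ m) (Circ (Var x))) \<longleftrightarrow> even m"
  by (induction m) (auto simp: neg_circ_Var neg_circ_Neg_funpow_Circ)

lemma not_val_consistency:
  "even n \<Longrightarrow> \<not> val n (Circ ((Neg ^^ n) (Circ (Var x))))"
  by (simp add: val_Neg_funpow_Circ_Var neg_circ_Neg_funpow_Circ)

lemma subst_Neg_funpow: "subst \<sigma> ((Neg ^^ j) A) = (Neg ^^ j) (subst \<sigma> A)"
  by (induction j) auto

lemma subst_Var: "subst Var A = A"
  by (induction A) auto

text \<open>One threshold must serve all substitutions, since rule instances are treated later and
  substitution can turn a formula into one satisfying \<open>neg_circ n\<close>.\<close>

lemma val_mCi_axiom:
  assumes "mCi_axiom A"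
  shows "\<exists>N. \<forall>n\<ge>N. \<forall>\<sigma>. val n (subst \<sigma> A)"
  using assms
proof cases
  case positive
  then show ?thesis by cases auto
next
  case (inconsistency A)
  \<comment> \<open>For \<open>n = 0\<close> every \<open>Neg (Circ A)\<close> would be true, even
    for consistent \<open>A\<close>.\<close>
  then show ?thesis by (intro exI[of _ 1]) (auto simp: neg_circ_Circ)
next
  case (consistency j A)
  then show ?thesis
    \<comment> \<open>Substitution preserves the height \<open>j\<close> of the inner formula, which
      thus never satisfies \<open>neg_circ n\<close> for \<open>n > j\<close>.\<close>
    by (intro exI[of _ "Suc j"]) (auto simp: subst_Neg_funpow neg_circ_Neg_funpow_Circ)
qed auto

text \<open>Modus ponens is sound in every \<open>val n\<close>, so only the finitely many axioms
  used in a derivation impose bounds.\<close>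

lemma val_mCi:
  assumes "\<Gamma> \<turnstile>\<^sub>m\<^sub>C\<^sub>i A"
  shows "\<exists>N. \<forall>n\<ge>N. \<forall>\<sigma>. (\<forall>B\<in>\<Gamma>. val n (subst \<sigma> B)) \<longrightarrow> val n (subst \<sigma> A)"
  using assms
proof induction
  case (premise A)
  then show ?case by blast
next
  case ("axiom" A)
  then show ?case using val_mCi_axiom by blast
next
  case (modus_ponens A B)
  then obtain M N where
    "\<forall>n\<ge>M. \<forall>\<sigma>. (\<forall>B\<in>\<Gamma>. val n (subst \<sigma> B)) \<longrightarrow> val n (subst \<sigma> A)"
    "\<forall>n\<ge>N. \<forall>\<sigma>. (\<forall>B\<in>\<Gamma>. val n (subst \<sigma> B)) \<longrightarrow> val n (subst \<sigma> (Imp A B))"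
    by blast
  then show ?case by (intro exI[of _ "max M N"]) auto
qed

section \<open>Disjunctions of finite succedents\<close>

text \<open>The last disjunct is a falsum, so that empty succedents need no special treatment.\<close>

definition disj :: "'v form list \<Rightarrow> 'v form" where
  "disj As = foldr Or As
     (let p = Var undefined in And (And p (Neg p)) (Circ p))"

text \<open>The falsum fails in every \<open>val n\<close> under every substitution:
  \<open>Circ p\<close> is false whenever \<open>p\<close> and \<open>Neg p\<close> are both
  true.\<close>

lemma val_disj: "val n (subst \<sigma> (disj As)) \<longleftrightarrow> (\<exists>A\<in>set As. val n (subst \<sigma> A))"
  by (induction As) (auto simp: disj_def Let_def)

lemma mCi_disj:
  assumes "A \<in> set As" "\<Gamma> \<turnstile>\<^sub>m\<^sub>C\<^sub>i A"
  shows "\<Gamma> \<turnstile>\<^sub>m\<^sub>C\<^sub>i disj As"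
  using assms(1)
proof (induction As)
  case (Cons B As)
  have "\<Gamma> \<turnstile>\<^sub>m\<^sub>C\<^sub>i Imp B (disj (B # As))" "\<Gamma> \<turnstile>\<^sub>m\<^sub>C\<^sub>i Imp (disj As) (disj (B # As))"
    by (auto simp: disj_def intro!: mCi.axiom mCi_axiom.positive positive_classical_axiom.intros)
  then show ?case
    using Cons assms(2) by (auto intro: mCi.modus_ponens)
qed simp

section \<open>Weakening and grafting of derivations\<close>

fun enlarge_label :: "'v form set \<Rightarrow> 'v label \<Rightarrow> 'v label" where
  "enlarge_label \<Gamma> (Formulas \<Delta>) = Formulas (\<Gamma> \<union> \<Delta>)"
| "enlarge_label \<Gamma> Discontinued = Discontinued"

primrec enlarge :: "'v form set \<Rightarrow> 'v tree \<Rightarrow> 'v tree" where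
  "enlarge \<Gamma> (Node l ts) = Node (enlarge_label \<Gamma> l) (map (enlarge \<Gamma>) ts)"

lemma root_label_enlarge: "root_label (enlarge \<Gamma> t) = enlarge_label \<Gamma> (root_label t)"
  by (cases t) simp

lemma leaf_labels_enlarge: "leaf_labels (enlarge \<Gamma> t) = enlarge_label \<Gamma> ` leaf_labels t"
  by (induction t) auto

lemma derivation_enlarge: "derivation H t \<Longrightarrow> derivation H (enlarge \<Gamma> t)"
proof (induction rule: derivation.induct)
  case (leaf l)
  then show ?case by (simp add: derivation.leaf)
next
  case (branch \<Phi> \<Psi> \<Delta> \<psi>s ts)
  have "map root_label (map (enlarge \<Gamma>) ts) = map (enlarge_label \<Gamma>) (map root_label ts)"
    by (simp add: root_label_enlarge)
  also have "\<dots> = map (\<lambda>\<psi>. Formulas ((\<Gamma> \<union> \<Delta>) \<union> {\<psi>})) \<psi>s"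
    unfolding branch(6) by simp
  finally have "map root_label (map (enlarge \<Gamma>) ts) = map (\<lambda>\<psi>. Formulas ((\<Gamma> \<union> \<Delta>) \<union> {\<psi>})) \<psi>s" .
  then have "derivation H (Node (Formulas (\<Gamma> \<union> \<Delta>)) (map (enlarge \<Gamma>) ts))"
    using branch by (intro derivation.branch[of \<Phi> \<Psi> H _ \<psi>s]) auto
  then show ?case by simp
next
  case (discontinue \<Phi> \<Delta>)
  then show ?case by (auto intro: derivation.discontinue)
qed

text \<open>Grafting needs exact root labels, whereas a proof only has its root included in
  \<open>\<Gamma>\<close>. Adding \<open>\<Gamma>\<close> to all labels keeps rules applicable and
  leaves closed.\<close>

lemma set_set_proof_root:
  assumes "set_set_conseq H \<Gamma> \<Delta>"
  obtains t where "set_set_proof H \<Gamma> \<Delta> t" "root_label t = Formulas \<Gamma>"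
proof -
  from assms obtain t \<Lambda> where t: "derivation H t" "root_label t = Formulas \<Lambda>" "\<Lambda> \<subseteq> \<Gamma>"
    "\<forall>l \<in> leaf_labels t. l = Discontinued \<or> (\<exists>\<Lambda>. l = Formulas \<Lambda> \<and> \<Lambda> \<inter> \<Delta> \<noteq> {})"
    unfolding set_set_conseq_def set_set_proof_def by blast
  then have root: "root_label (enlarge \<Gamma> t) = Formulas \<Gamma>"
    by (auto simp: root_label_enlarge)
  moreover have "\<forall>l \<in> leaf_labels (enlarge \<Gamma> t).
      l = Discontinued \<or> (\<exists>\<Lambda>. l = Formulas \<Lambda> \<and> \<Lambda> \<inter> \<Delta> \<noteq> {})"
    using t(4) unfolding leaf_labels_enlarge by fastforce
  ultimately have "set_set_proof H \<Gamma> \<Delta> (enlarge \<Gamma> t)"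
    unfolding set_set_proof_def using derivation_enlarge[OF t(1)] by blast
  with root that show thesis by blast
qed

text \<open>The proofs for the single \<psi> are hung as subtrees below a new root
  \<open>\<Gamma>\<close> expanded by the rule.\<close>

lemma set_set_conseq_rule:
  assumes rule: "(\<Phi>, \<Psi>) \<in> rule_instances H" and "finite \<Psi>" "\<Phi> \<subseteq> \<Gamma>"
    and prems: "\<And>\<psi>. \<psi> \<in> \<Psi> \<Longrightarrow> set_set_conseq H (\<Gamma> \<union> {\<psi>}) \<Delta>"
  shows "set_set_conseq H \<Gamma> \<Delta>"
proof (cases "\<Psi> = {}")
  case True
  then have "derivation H (Node (Formulas \<Gamma>) [Node Discontinued []])"
    using assms by (auto intro: derivation.discontinue)
  then have "set_set_proof H \<Gamma> \<Delta> (Node (Formulas \<Gamma>) [Node Discontinued []])"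
    by (auto simp: set_set_proof_def)
  then show ?thesis unfolding set_set_conseq_def by blast
next
  case False
  have "\<exists>t. set_set_proof H (\<Gamma> \<union> {\<psi>}) \<Delta> t \<and> root_label t = Formulas (\<Gamma> \<union> {\<psi>})"
    if "\<psi> \<in> \<Psi>" for \<psi>
    using set_set_proof_root[OF prems[OF that]] by blast
  then obtain f where
    f: "\<And>\<psi>. \<psi> \<in> \<Psi> \<Longrightarrow> set_set_proof H (\<Gamma> \<union> {\<psi>}) \<Delta> (f \<psi>)"
       "\<And>\<psi>. \<psi> \<in> \<Psi> \<Longrightarrow> root_label (f \<psi>) = Formulas (\<Gamma> \<union> {\<psi>})"
    by metis
  obtain \<psi>s where \<psi>s: "distinct \<psi>s" "set \<psi>s = \<Psi>"
    using finite_distinct_list[OF \<open>finite \<Psi>\<close>] by blast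
  have "derivation H (Node (Formulas \<Gamma>) (map f \<psi>s))"
    using rule \<open>\<Phi> \<subseteq> \<Gamma>\<close> False \<psi>s
    by (rule derivation.branch) (use f \<psi>s in \<open>auto simp: set_set_proof_def\<close>)
  moreover have "\<forall>l \<in> leaf_labels (Node (Formulas \<Gamma>) (map f \<psi>s)).
      l = Discontinued \<or> (\<exists>\<Lambda>. l = Formulas \<Lambda> \<and> \<Lambda> \<inter> \<Delta> \<noteq> {})"
    using f(1) \<psi>s False by (auto simp: set_set_proof_def)
  ultimately have "set_set_proof H \<Gamma> \<Delta> (Node (Formulas \<Gamma>) (map f \<psi>s))"
    unfolding set_set_proof_def by auto
  then show ?thesis unfolding set_set_conseq_def by blast
qed

section \<open>Soundness of Set-Set derivations\<close>

lemma derivation_true_leaf: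
  assumes "derivation H t"
    and "\<And>\<Phi> \<Psi>. (\<Phi>, \<Psi>) \<in> rule_instances H \<Longrightarrow> \<forall>A\<in>\<Phi>. P A \<Longrightarrow> \<exists>B\<in>\<Psi>. P B"
    and "root_label t = Formulas \<Lambda>" "\<forall>A\<in>\<Lambda>. P A"
  shows "\<exists>\<Delta>. Formulas \<Delta> \<in> leaf_labels t \<and> (\<forall>A\<in>\<Delta>. P A)"
  using assms(1,3,4)
proof (induction arbitrary: \<Lambda> rule: derivation.induct)
  case (leaf l)
  then show ?case by auto
next
  case (branch \<Phi> \<Psi> \<Delta> \<psi>s ts)
  then have "\<Lambda> = \<Delta>" by simp
  \<comment> \<open>Soundness of the rule selects a child whose label is again true throughout; the
    true path continues there.\<close>
  then obtain \<psi> where "\<psi> \<in> set \<psi>s" "P \<psi>"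
    using branch assms(2)[of \<Phi> \<Psi>] by blast
  then have "Formulas (\<Delta> \<union> {\<psi>}) \<in> set (map root_label ts)"
    unfolding branch(6) by auto
  then obtain t where t: "t \<in> set ts" "root_label t = Formulas (\<Delta> \<union> {\<psi>})"
    by auto
  have "\<exists>\<Delta>. Formulas \<Delta> \<in> leaf_labels t \<and> (\<forall>A\<in>\<Delta>. P A)"
    using branch.IH[OF t] branch.prems \<open>P \<psi>\<close> \<open>\<Lambda> = \<Delta>\<close> by auto
  then show ?case using t(1) by auto
next
  case (discontinue \<Phi> \<Delta>)
  \<comment> \<open>A true path cannot reach a star: soundness would demand a true member of the
    empty succedent.\<close>
  then show ?case using assms(2)[of \<Phi> "{}"] by auto
qed

lemma set_set_conseq_true:
  assumes "set_set_conseq H \<Gamma> {\<phi>}" "\<forall>A\<in>\<Gamma>. P A"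
    and "\<And>\<Phi> \<Psi>. (\<Phi>, \<Psi>) \<in> rule_instances H \<Longrightarrow> \<forall>A\<in>\<Phi>. P A \<Longrightarrow> \<exists>B\<in>\<Psi>. P B"
  shows "P \<phi>"
proof -
  from set_set_proof_root[OF assms(1)]
  obtain t where t: "set_set_proof H \<Gamma> {\<phi>} t" "root_label t = Formulas \<Gamma>" .
  then have "derivation H t" by (simp add: set_set_proof_def)
  then have "\<exists>\<Delta>. Formulas \<Delta> \<in> leaf_labels t \<and> (\<forall>A\<in>\<Delta>. P A)"
    using assms(3) t(2) assms(2) by (rule derivation_true_leaf)
  then obtain \<Delta> where "Formulas \<Delta> \<in> leaf_labels t" "\<forall>A\<in>\<Delta>. P A" by blast
  with t(1) show ?thesis unfolding set_set_proof_def by blast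
qed

section \<open>Bounding finitely many rules\<close>

lemma val_rule:
  assumes rule: "(\<Phi>, \<Psi>) \<in> H" "finite \<Psi>"
    and conseq: "\<And>\<Gamma> \<phi>. set_set_conseq H \<Gamma> {\<phi>} \<longleftrightarrow> \<Gamma> \<turnstile>\<^sub>m\<^sub>C\<^sub>i \<phi>"
  shows "\<exists>N. \<forall>n\<ge>N. \<forall>\<sigma>. (\<forall>A\<in>\<Phi>. val n (subst \<sigma> A)) \<longrightarrow> (\<exists>B\<in>\<Psi>. val n (subst \<sigma> B))"
proof -
  obtain \<psi>s where \<psi>s: "set \<psi>s = \<Psi>"
    using finite_list[OF rule(2)] by blast
  have "(\<Phi>, \<Psi>) = (subst Var ` \<Phi>, subst Var ` \<Psi>)"
    by (simp add: subst_Var)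
  with rule(1) have "(\<Phi>, \<Psi>) \<in> rule_instances H"
    unfolding rule_instances_def by blast
  \<comment> \<open>Applying the schema to itself leaves, for each \<psi> in \<open>\<Psi>\<close>,
    a branch that closes because \<psi> derives the disjunction in mCi. The assumed equivalence then
    carries the result back to mCi.\<close>
  then have "set_set_conseq H \<Phi> {disj \<psi>s}"
    using rule(2)
    by (rule set_set_conseq_rule) (auto simp: conseq \<psi>s intro: mCi_disj mCi.premise)
  then show ?thesis
    using val_mCi[of \<Phi> "disj \<psi>s"] by (simp add: conseq val_disj \<psi>s)
qed

theorem theorem4:
  "\<not> (\<exists>H :: ('v :: {countable, infinite}) rule_schema set.
        set_set_system H \<and> finite H \<and>
        (\<forall>\<Gamma> \<phi>. set_set_conseq H \<Gamma> {\<phi>} \<longleftrightarrow> \<Gamma> \<turnstile>\<^sub>m\<^sub>C\<^sub>i \<phi>))"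
proof
  assume "\<exists>H :: 'v rule_schema set.
        set_set_system H \<and> finite H \<and>
        (\<forall>\<Gamma> \<phi>. set_set_conseq H \<Gamma> {\<phi>} \<longleftrightarrow> \<Gamma> \<turnstile>\<^sub>m\<^sub>C\<^sub>i \<phi>)"
  then obtain H :: "'v rule_schema set" where H: "set_set_system H" "finite H"
    "\<And>\<Gamma> \<phi>. set_set_conseq H \<Gamma> {\<phi>} \<longleftrightarrow> \<Gamma> \<turnstile>\<^sub>m\<^sub>C\<^sub>i \<phi>" by blast
  have "\<exists>N. \<forall>n\<ge>N. \<forall>\<sigma>. (\<forall>A\<in>fst r. val n (subst \<sigma> A)) \<longrightarrow> (\<exists>B\<in>snd r. val n (subst \<sigma> B))"
    if "r \<in> H" for r
    using val_rule[of "fst r" "snd r" H] that H(1,3) by (auto simp: set_set_system_def)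
  then obtain N where N: "\<And>r n \<sigma>. r \<in> H \<Longrightarrow> n \<ge> N r \<Longrightarrow>
      \<forall>A\<in>fst r. val n (subst \<sigma> A) \<Longrightarrow> \<exists>B\<in>snd r. val n (subst \<sigma> B)"
    by metis
  \<comment> \<open>The sum over the finite set \<open>H\<close> dominates every threshold; doubling
    makes \<open>n\<close> even, as refuting \<open>?A\<close> requires.\<close>
  define n where "n = 2 * (\<Sum>r\<in>H. N r)"
  have n: "n \<ge> N r" if "r \<in> H" for r
    using member_le_sum[OF that, of N] H(2) by (simp add: n_def)
  let ?A = "Circ ((Neg ^^ n) (Circ (Var undefined))) :: 'v form"
  have "{} \<turnstile>\<^sub>m\<^sub>C\<^sub>i ?A"
    by (intro mCi.axiom mCi_axiom.consistency)
  then have "set_set_conseq H {} {?A}" by (simp only: H(3))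
  then have "val n ?A"
  proof (rule set_set_conseq_true)
    show "\<exists>B\<in>\<Psi>. val n B"
      if "(\<Phi>, \<Psi>) \<in> rule_instances H" "\<forall>A\<in>\<Phi>. val n A" for \<Phi> \<Psi>
      using that N[OF _ n] by (fastforce simp: rule_instances_def)
  qed simp
  then show False
    using not_val_consistency n_def by (metis dvd_triv_left)
qed

end
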